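(* Let $G$ be a connected finite simple graph and let $u\in V(G)$. Then $$D_t(G,x)=D_t(G-u,x)+x\,D_t(G/u,x)-(1+x)\,D_t(G/u,x)\{N_G(u)\cap W=\emptyset\}+\sum_{v\in N_G(u)}x^2\,1_{G\ominus u\ominus v}.$$
   Context: All graphs are finite, simple and undirected. For a vertex $v$, $N_G(v)$ is its open neighborhood and $N_G[v]=N_G(v)\cup\{v\}$ its closed neighborhood. A set $D\subseteq V(G)$ is a total dominating set of $G$ if every vertex of $G$ (including those in $D$) is adjacent to some vertex of $D$. Writing $d_t(G,i)$ for the number of total dominating sets of $G$ of size $i$, the total domination polynomial is $D_t(G,x)=\sum_{i=1}^{|V(G)|}d_t(G,i)x^i$; in particular $D_t(H,x)=0$ if $H$ has no vertices. $G-u$ is the subgraph induced by $V(G)\setminus\{u\}$. $G/u$ is the graph obtained from $G$ by deleting $u$ and adding an edge between every pair of non-adjacent vertices of $N_G(u)$. $G\ominus u\ominus v$ is the subgraph induced by $V(G)\setminus(N_G[u]\cup N_G[v])$. The quantity $1_{G\ominus u\ominus v}$ equals $1$ if $G\ominus u\ominus v$ has no vertices and equals $D_t(G\ominus u\ominus v,x)$ otherwise. For a graph $H$ and a condition $C$ on vertex sets, $D_t(H,x)\{C\}=\sum x^{|W|}$, the sum running over all total dominating sets $W$ of $H$ satisfying $C$; so $D_t(G/u,x)\{N_G(u)\cap W=\emptyset\}$ is the generating polynomial of the total dominating sets $W$ of $G/u$ containing no vertex of $N_G(u)$. *)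

theory Defs
  imports
    "HOL-Computational_Algebra.Polynomial"
    "Graph_Theory.Digraph_Component"
    "Graph_Theory.Pair_Digraph"
begin

text \<open>
  Finite simple undirected graphs are the \<open>pair_graph\<close>s of the AFP entry \<open>Graph_Theory\<close>:
  finite, loop-free digraphs whose arcs are pairs and form a symmetric relation.
  Operations yielding an induced subgraph have type \<open>pre_digraph\<close> there, so the notions below
  are stated for \<open>pre_digraph\<close> and applied to a \<open>pair_graph\<close> through \<open>with_proj\<close>.
\<close>

definition open_nbhd :: "('a, 'b) pre_digraph \<Rightarrow> 'a \<Rightarrow> 'a set" where
  "open_nbhd G v = {w. v \<rightarrow>\<^bsub>G\<^esub> w}"

definition closed_nbhd :: "('a, 'b) pre_digraph \<Rightarrow> 'a \<Rightarrow> 'a set" where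
  "closed_nbhd G v = insert v (open_nbhd G v)"

definition total_dominating_set :: "('a, 'b) pre_digraph \<Rightarrow> 'a set \<Rightarrow> bool" where
  "total_dominating_set G D \<longleftrightarrow> D \<subseteq> verts G \<and> (\<forall>v\<in>verts G. \<exists>w\<in>D. v \<rightarrow>\<^bsub>G\<^esub> w)"

definition tds_count :: "('a, 'b) pre_digraph \<Rightarrow> nat \<Rightarrow> nat" where
  "tds_count G i = card {D. total_dominating_set G D \<and> card D = i}"

definition total_dom_poly :: "('a, 'b) pre_digraph \<Rightarrow> int poly" where
  "total_dom_poly G = (\<Sum>i = 1..card (verts G). monom (int (tds_count G i)) i)"

text \<open>
  The condition \<open>W \<noteq> {}\<close> matches the summation range \<open>i \<ge> 1\<close> of \<open>total_dom_poly\<close>. It only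
  matters for the graph without vertices, of which the empty set is vacuously a total
  dominating set: there the restricted polynomial is 0, like the unrestricted one.
\<close>

definition total_dom_poly_restricted ::
    "('a, 'b) pre_digraph \<Rightarrow> ('a set \<Rightarrow> bool) \<Rightarrow> int poly" where
  "total_dom_poly_restricted H C =
     (\<Sum>W | total_dominating_set H W \<and> W \<noteq> {} \<and> C W. monom 1 (card W))"

lemma total_dom_poly_restricted_True:
  assumes "finite (verts H)"
  shows "total_dom_poly_restricted H (\<lambda>_. True) = total_dom_poly H"
proof -
  let ?T = "{W. total_dominating_set H W \<and> W \<noteq> {}}"
  have sub: "W \<subseteq> verts H" if "W \<in> ?T" for W
    using that by (simp add: total_dominating_set_def)
  have fin: "finite ?T"
    by (rule finite_subset[of _ "Pow (verts H)"]) (use sub assms in auto)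
  have img: "card ` ?T \<subseteq> {1..card (verts H)}"
  proof clarify
    fix W assume W: "total_dominating_set H W" "W \<noteq> {}"
    then have "W \<subseteq> verts H" by (simp add: total_dominating_set_def)
    with W assms show "card W \<in> {1..card (verts H)}"
      by (auto simp: Suc_le_eq card_gt_0_iff intro: card_mono finite_subset)
  qed
  have "total_dom_poly_restricted H (\<lambda>_. True) = (\<Sum>W\<in>?T. monom 1 (card W))"
    by (simp add: total_dom_poly_restricted_def)
  also have "\<dots> = (\<Sum>i = 1..card (verts H). \<Sum>W | W \<in> ?T \<and> card W = i. monom 1 (card W))"
    by (rule sum.group[OF fin _ img, symmetric]) simp
  also have "\<dots> = total_dom_poly H"
    unfolding total_dom_poly_def
  proof (rule sum.cong[OF refl])
    fix i assume "i \<in> {1..card (verts H)}"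
    then have eq: "{W. W \<in> ?T \<and> card W = i} = {D. total_dominating_set H D \<and> card D = i}"
      by auto
    have "(\<Sum>W | W \<in> ?T \<and> card W = i. monom (1::int) (card W)) =
        (\<Sum>W | W \<in> ?T \<and> card W = i. monom 1 i)"
      by (rule sum.cong) auto
    also have "\<dots> = of_nat (tds_count H i) * monom 1 i"
      unfolding eq by (simp add: tds_count_def)
    also have "\<dots> = monom (int (tds_count H i)) i"
      by (simp add: of_nat_poly smult_monom)
    finally show "(\<Sum>W | W \<in> ?T \<and> card W = i. monom 1 (card W)) =
        monom (int (tds_count H i)) i" .
  qed
  finally show ?thesis .
qed

definition del_vertex :: "'a pair_pre_digraph \<Rightarrow> 'a \<Rightarrow> ('a, 'a \<times> 'a) pre_digraph" where
  "del_vertex G u = with_proj G \<restriction> (pverts G - {u})"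

definition contract_vertex :: "'a pair_pre_digraph \<Rightarrow> 'a \<Rightarrow> 'a pair_pre_digraph" where
  "contract_vertex G u =
     \<lparr> pverts = pverts G - {u},
       parcs = {(a, b) \<in> parcs G. a \<noteq> u \<and> b \<noteq> u} \<union>
         {(a, b). a \<in> open_nbhd (with_proj G) u \<and> b \<in> open_nbhd (with_proj G) u \<and> a \<noteq> b} \<rparr>"

lemma pair_graph_contract_vertex:
  assumes "pair_graph G"
  shows "pair_graph (contract_vertex G u)"
proof -
  interpret pair_graph G by fact
  have "parcs (contract_vertex G u) \<subseteq> pverts G \<times> pverts G"
    by (auto simp: contract_vertex_def open_nbhd_def dest: in_arcsD1 in_arcsD2)
  then have "finite (parcs (contract_vertex G u))"
    by (rule finite_subset) simp
  moreover have "symmetric (with_proj (contract_vertex G u))"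
    by (auto simp: symmetric_def contract_vertex_def intro!: symI dest: arcs_symmetric)
  ultimately show ?thesis
    by unfold_locales
      (auto simp: contract_vertex_def open_nbhd_def dest: in_arcsD1 in_arcsD2 no_loops')
qed

definition del_closed_nbhds ::
    "'a pair_pre_digraph \<Rightarrow> 'a \<Rightarrow> 'a \<Rightarrow> ('a, 'a \<times> 'a) pre_digraph" where
  "del_closed_nbhds G u v =
     with_proj G \<restriction> (pverts G - (closed_nbhd (with_proj G) u \<union> closed_nbhd (with_proj G) v))"

definition total_dom_poly_or_1 :: "('a, 'b) pre_digraph \<Rightarrow> int poly" where
  "total_dom_poly_or_1 H = (if verts H = {} then 1 else total_dom_poly H)"

abbreviation polyX :: "int poly" where
  "polyX \<equiv> [:0, 1:]"

end

theory Submission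
  imports Defs
begin

text \<open>
  Let \<open>N\<close> be the neighbourhood of \<open>u\<close>. The total dominating sets of \<open>G\<close> avoiding \<open>u\<close> are those of
  \<open>G - u\<close> that meet \<open>N\<close>, and a set avoiding \<open>N\<close> is total dominating in \<open>G - u\<close> iff it is in \<open>G/u\<close>.
  Those containing \<open>u\<close> are \<open>U \<union> {u}\<close>, where \<open>U\<close> avoids \<open>u\<close>, meets \<open>N\<close> and dominates every vertex
  outside \<open>N \<union> {u}\<close>. Such a \<open>U\<close> is total dominating in \<open>G/u\<close> unless \<open>U \<inter> N = {v}\<close> and \<open>U\<close>
  contains no neighbour of \<open>v\<close>; in that case \<open>U - {v}\<close> is an arbitrary total dominating set of
  \<open>G \<ominus> u \<ominus> v\<close>.
\<close>

text \<open>Common form for every polynomial in the identity, which thereby reduces to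
  decompositions of families of sets.\<close>

definition size_poly :: "'a set set \<Rightarrow> int poly" where
  "size_poly \<A> = (\<Sum>W\<in>\<A>. monom 1 (card W))"

lemma size_poly_Un_disjoint:
  "\<lbrakk>finite \<A>; finite \<B>; \<A> \<inter> \<B> = {}\<rbrakk> \<Longrightarrow> size_poly (\<A> \<union> \<B>) = size_poly \<A> + size_poly \<B>"
  unfolding size_poly_def by (rule sum.union_disjoint)

text \<open>Every member misses \<open>v\<close>, so inserting \<open>v\<close> is injective on the
  family and raises each size by one.\<close>

lemma size_poly_insert_image:
  assumes "\<And>W. W \<in> \<A> \<Longrightarrow> finite W \<and> v \<notin> W"
  shows "size_poly (insert v ` \<A>) = polyX * size_poly \<A>"
proof -
  have inj: "inj_on (insert v) \<A>"
    using assms by (auto intro!: inj_onI dest: insert_ident)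
  show ?thesis
    unfolding size_poly_def sum.reindex[OF inj] sum_distrib_left
    by (rule sum.cong) (use assms in \<open>auto simp: monom_Suc\<close>)
qed

lemma total_dom_poly_restricted_eq:
  "total_dom_poly_restricted H C = size_poly {W. total_dominating_set H W \<and> W \<noteq> {} \<and> C W}"
  by (simp add: total_dom_poly_restricted_def size_poly_def)

lemma total_dom_poly_eq:
  assumes "finite (verts H)"
  shows "total_dom_poly H = size_poly {W. total_dominating_set H W \<and> W \<noteq> {}}"
  using total_dom_poly_restricted_True[OF assms]
  by (simp add: total_dom_poly_restricted_eq)

text \<open>The value 1 on the graph without vertices is the term of the empty set, which is total
  dominating only there; hence no non-emptiness condition remains.\<close>

lemma total_dom_poly_or_1_eq:
  assumes "finite (verts H)"
  shows "total_dom_poly_or_1 H = size_poly {W. total_dominating_set H W}"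
proof (cases "verts H = {}")
  case True
  then have "{W. total_dominating_set H W} = {{}}"
    by (auto simp: total_dominating_set_def)
  with True show ?thesis
    by (simp add: total_dom_poly_or_1_def size_poly_def)
next
  case False
  then have "{W. total_dominating_set H W} = {W. total_dominating_set H W \<and> W \<noteq> {}}"
    by (auto simp: total_dominating_set_def)
  with False show ?thesis
    by (simp add: total_dom_poly_or_1_def total_dom_poly_eq[OF assms])
qed

lemma total_dominating_set_with_proj:
  "total_dominating_set (with_proj G) W \<longleftrightarrow>
    W \<subseteq> pverts G \<and> (\<forall>v\<in>pverts G. \<exists>w\<in>W. (v, w) \<in> parcs G)"
  by (simp add: total_dominating_set_def arcs_ends_def arc_to_ends_def)

lemma total_dominating_set_induced:
  "total_dominating_set (with_proj G \<restriction> S) W \<longleftrightarrow>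
    W \<subseteq> S \<and> (\<forall>v\<in>S. \<exists>w\<in>W. (v, w) \<in> parcs G)"
  by (fastforce simp: total_dominating_set_def arcs_ends_def arc_to_ends_def image_iff)

lemma open_nbhd_with_proj: "open_nbhd (with_proj G) v = {w. (v, w) \<in> parcs G}"
  by (simp add: open_nbhd_def arcs_ends_def arc_to_ends_def)

theorem theorem1:
  fixes G :: "'a pair_pre_digraph" and u :: 'a
  assumes "pair_graph G"
    and "Digraph_Component.connected (with_proj G)"
    and "u \<in> pverts G"
  shows "total_dom_poly (with_proj G) =
      total_dom_poly (del_vertex G u)
    + polyX * total_dom_poly (with_proj (contract_vertex G u))
    - (1 + polyX) * total_dom_poly_restricted (with_proj (contract_vertex G u))
        (\<lambda>W. open_nbhd (with_proj G) u \<inter> W = {})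
    + (\<Sum>v\<in>open_nbhd (with_proj G) u.
        polyX ^ 2 * total_dom_poly_or_1 (del_closed_nbhds G u v))"
proof -
  interpret pair_graph G by fact
  define V where "V = pverts G"
  define E where "E = parcs G"
  define N where "N = open_nbhd (with_proj G) u"
  \<comment> \<open>The vertex set of G \<ominus> u \<ominus> v, whose total dominating sets form
    \<open>\<B> v\<close> below.\<close>
  define S where "S v = V - ({u} \<union> N \<union> {v} \<union> {w. (v, w) \<in> E})" for v
  have finV: "finite V" and uV: "u \<in> V"
    using assms by (simp_all add: V_def)
  have sym: "(b, a) \<in> E" if "(a, b) \<in> E" for a b
    using that arcs_symmetric by (simp add: E_def)
  have irrefl: "(a, a) \<notin> E" for a
    using no_loops' by (auto simp: E_def)
  have N: "w \<in> N \<longleftrightarrow> (u, w) \<in> E" for w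
    by (simp add: N_def open_nbhd_with_proj E_def)
  have EV: "a \<in> V" "b \<in> V" if "(a, b) \<in> E" for a b
    using that by (auto simp: E_def V_def dest: in_arcsD1 in_arcsD2)
  have NV: "N \<subseteq> V - {u}"
    using N EV irrefl by blast
  have finN: "finite N"
    using NV finV by (meson finite_Diff finite_subset)

  \<comment> \<open>\<open>\<A>\<close> collects the total dominating sets of \<open>G\<close>
    without \<open>u\<close>, and \<open>\<U>\<close> what remains of the others once
    \<open>u\<close> is removed: \<open>u\<close> still needs a neighbour in the set, whereas
    \<open>u\<close> takes care of \<open>N\<close>.\<close>
  define \<A> where "\<A> = {W. W \<subseteq> V - {u} \<and> W \<noteq> {} \<and> (\<forall>v\<in>V. \<exists>w\<in>W. (v, w) \<in> E)}"
  define \<U> where "\<U> = {U. U \<subseteq> V - {u} \<and> U \<inter> N \<noteq> {} \<and> (\<forall>v\<in>V - {u} - N. \<exists>w\<in>U. (v, w) \<in> E)}"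
  \<comment> \<open>One family serves both G - u and G/u: a set avoiding \<open>N\<close> cannot use
    the edges added by the contraction.\<close>
  define \<R> where "\<R> = {W. W \<subseteq> V - {u} \<and> W \<noteq> {} \<and> N \<inter> W = {} \<and> (\<forall>v\<in>V - {u}. \<exists>w\<in>W. (v, w) \<in> E)}"
  \<comment> \<open>The total dominating sets of G/u that meet \<open>N\<close>; the second disjunct
    is the clique that the contraction puts on \<open>N\<close>.\<close>
  define \<T> where "\<T> = {U. U \<subseteq> V - {u} \<and> U \<inter> N \<noteq> {} \<and>
    (\<forall>v\<in>V - {u}. \<exists>w\<in>U. (v, w) \<in> E \<or> v \<in> N \<and> w \<in> N \<and> v \<noteq> w)}"
  define \<B> where "\<B> v = {W. W \<subseteq> S v \<and> (\<forall>y\<in>S v. \<exists>w\<in>W. (y, w) \<in> E)}" for v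
  have fin_fam: "finite \<F>" if "\<And>W. W \<in> \<F> \<Longrightarrow> W \<subseteq> V" for \<F>
    using that finV by (meson Pow_iff finite_Pow_iff finite_subset subsetI)
  have fin: "finite \<A>" "finite \<U>" "finite \<R>" "finite \<T>" "finite (\<B> v)" for v
    by (rule fin_fam; auto simp: \<A>_def \<U>_def \<R>_def \<T>_def \<B>_def S_def)+

  have G: "{W. total_dominating_set (with_proj G) W \<and> W \<noteq> {}} = \<A> \<union> insert u ` \<U>"
  proof (intro equalityI subsetI)
    fix W assume "W \<in> {W. total_dominating_set (with_proj G) W \<and> W \<noteq> {}}"
    then have W: "W \<subseteq> V" "W \<noteq> {}" "\<forall>v\<in>V. \<exists>w\<in>W. (v, w) \<in> E"
      by (auto simp: total_dominating_set_with_proj V_def E_def)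
    show "W \<in> \<A> \<union> insert u ` \<U>"
    proof (cases "u \<in> W")
      case False
      with W show ?thesis by (auto simp: \<A>_def)
    next
      case True
      have "\<exists>w\<in>W. (u, w) \<in> E" using W uV by blast
      then have "(W - {u}) \<inter> N \<noteq> {}" using irrefl by (auto simp: N)
      moreover have "\<exists>w\<in>W - {u}. (v, w) \<in> E" if "v \<in> V - {u} - N" for v
      proof -
        from that W(3) obtain w where "w \<in> W" "(v, w) \<in> E" by blast
        \<comment> \<open>As \<open>v\<close> is outside \<open>N\<close>, it is not dominated by
          \<open>u\<close>.\<close>
        moreover have "w \<noteq> u" using that \<open>(v, w) \<in> E\<close> sym by (auto simp: N)
        ultimately show ?thesis by blast
      qed
      ultimately have "W - {u} \<in> \<U>" using W by (auto simp: \<U>_def)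
      then show ?thesis using True by (metis UnI2 image_eqI insert_Diff)
    qed
  next
    fix W assume "W \<in> \<A> \<union> insert u ` \<U>"
    then show "W \<in> {W. total_dominating_set (with_proj G) W \<and> W \<noteq> {}}"
    proof
      assume "W \<in> \<A>"
      then show ?thesis
        by (auto simp: \<A>_def total_dominating_set_with_proj V_def E_def)
    next
      assume "W \<in> insert u ` \<U>"
      then obtain U where U: "W = insert u U" "U \<subseteq> V - {u}" "U \<inter> N \<noteq> {}"
        "\<forall>v\<in>V - {u} - N. \<exists>w\<in>U. (v, w) \<in> E" by (auto simp: \<U>_def)
      have "\<exists>w\<in>W. (v, w) \<in> E" if "v \<in> V" for v
      proof (cases "v \<in> N")
        case True
        then have "(v, u) \<in> E" by (simp add: N sym)
        then show ?thesis using U(1) by blast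
      next
        case False
        have "\<exists>w\<in>W. (u, w) \<in> E" using U(1,3) N by blast
        with False that U(1,4) show ?thesis by blast
      qed
      then show ?thesis
        using U uV by (auto simp: total_dominating_set_with_proj V_def E_def)
    qed
  qed
  \<comment> \<open>A total dominating set of G - u also dominates \<open>u\<close> exactly when it
    meets \<open>N\<close>.\<close>
  have A_R: "{W. total_dominating_set (del_vertex G u) W \<and> W \<noteq> {}} = \<A> \<union> \<R>"
    unfolding del_vertex_def total_dominating_set_induced V_def[symmetric] E_def[symmetric]
      \<A>_def \<R>_def using N uV by blast
  have arcs: "parcs (contract_vertex G u) =
      {(a, b) \<in> E. a \<noteq> u \<and> b \<noteq> u} \<union> {(a, b). a \<in> N \<and> b \<in> N \<and> a \<noteq> b}"
    "pverts (contract_vertex G u) = V - {u}"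
    by (auto simp: contract_vertex_def V_def E_def N_def)
  have contr: "total_dominating_set (with_proj (contract_vertex G u)) W \<longleftrightarrow> W \<subseteq> V - {u} \<and>
      (\<forall>v\<in>V - {u}. \<exists>w\<in>W. (v, w) \<in> E \<or> v \<in> N \<and> w \<in> N \<and> v \<noteq> w)" for W
    unfolding total_dominating_set_with_proj arcs by blast
  have R: "{W. total_dominating_set (with_proj (contract_vertex G u)) W \<and> W \<noteq> {} \<and> N \<inter> W = {}} = \<R>"
    unfolding contr \<R>_def by blast
  have T_R: "{W. total_dominating_set (with_proj (contract_vertex G u)) W \<and> W \<noteq> {}} = \<T> \<union> \<R>"
    unfolding R[symmetric] unfolding contr \<T>_def by blast
  have B: "{W. total_dominating_set (del_closed_nbhds G u v) W} = \<B> v" for v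
  proof -
    have "del_closed_nbhds G u v = with_proj G \<restriction> S v"
      unfolding del_closed_nbhds_def S_def closed_nbhd_def N_def[symmetric]
      by (rule arg_cong[where f = "\<lambda>X. with_proj G \<restriction> X"])
        (auto simp: V_def E_def open_nbhd_with_proj)
    then show ?thesis
      by (simp add: total_dominating_set_induced \<B>_def E_def)
  qed
  have U: "\<U> = \<T> \<union> (\<Union>v\<in>N. insert v ` \<B> v)"
  proof (intro equalityI subsetI)
    fix U assume "U \<in> \<U>"
    then have U: "U \<subseteq> V - {u}" "U \<inter> N \<noteq> {}" "\<forall>v\<in>V - {u} - N. \<exists>w\<in>U. (v, w) \<in> E"
      by (auto simp: \<U>_def)
    show "U \<in> \<T> \<union> (\<Union>v\<in>N. insert v ` \<B> v)"
    proof (cases "U \<in> \<T>")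
      case False
      with U obtain v where v: "v \<in> V - {u}"
        "\<forall>w\<in>U. (v, w) \<notin> E \<and> \<not> (v \<in> N \<and> w \<in> N \<and> v \<noteq> w)" by (auto simp: \<T>_def)
      \<comment> \<open>The undominated \<open>v\<close> must be in \<open>N\<close>, since
        \<open>U\<close> dominates everything else in G - u. Any other element of
        \<open>U \<inter> N\<close> would dominate \<open>v\<close> through the clique on
        \<open>N\<close>.\<close>
      with U have vN: "v \<in> N" by blast
      with v U have UN: "U \<inter> N = {v}" by blast
      \<comment> \<open>Apart from \<open>v\<close>, the set \<open>U\<close> contains no element of
        \<open>N\<close> and no neighbour of \<open>v\<close>.\<close>
      have "U - {v} \<subseteq> S v" using U v UN by (auto simp: S_def)
      moreover have "\<exists>w\<in>U - {v}. (y, w) \<in> E" if "y \<in> S v" for y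
      proof -
        from that U(3) obtain w where "w \<in> U" "(y, w) \<in> E" unfolding S_def by blast
        moreover have "w \<noteq> v" using that \<open>(y, w) \<in> E\<close> sym by (auto simp: S_def)
        ultimately show ?thesis by blast
      qed
      ultimately have "U - {v} \<in> \<B> v" by (auto simp: \<B>_def)
      then have "U \<in> insert v ` \<B> v" using UN by (metis IntD1 image_eqI insertI1 insert_Diff)
      then show ?thesis using vN by blast
    qed simp
  next
    fix U assume "U \<in> \<T> \<union> (\<Union>v\<in>N. insert v ` \<B> v)"
    then show "U \<in> \<U>"
    proof
      assume "U \<in> \<T>"
      then show ?thesis unfolding \<T>_def \<U>_def by blast
    next
      assume "U \<in> (\<Union>v\<in>N. insert v ` \<B> v)"
      then obtain v W where v: "v \<in> N" "U = insert v W" "W \<subseteq> S v"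
        "\<forall>y\<in>S v. \<exists>w\<in>W. (y, w) \<in> E" by (auto simp: \<B>_def)
      have "\<exists>w\<in>U. (y, w) \<in> E" if "y \<in> V - {u} - N" for y
      \<comment> \<open>The inserted \<open>v\<close> dominates its own neighbours; every other
        \<open>y\<close> considered here lies in \<open>S v\<close>, which \<open>W\<close>
        dominates.\<close>
      proof (cases "(v, y) \<in> E")
        case True
        then show ?thesis using v(2) sym by blast
      next
        case False
        with that v(1) have "y \<in> S v" by (auto simp: S_def)
        then show ?thesis using v(2,4) by blast
      qed
      then show ?thesis using v NV by (auto simp: \<U>_def S_def)
    qed
  qed
  \<comment> \<open>The vertex left undominated in G/u is \<open>v\<close>: the set \<open>W\<close>
    avoids both \<open>N\<close> and the neighbours of \<open>v\<close>.\<close>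
  have not_T: "insert v W \<notin> \<T>" if "v \<in> N" "W \<in> \<B> v" for v W
  proof
    assume "insert v W \<in> \<T>"
    then obtain w where "w \<in> insert v W" "(v, w) \<in> E \<or> w \<in> N \<and> v \<noteq> w"
      using that NV unfolding \<T>_def by blast
    then show False
      using that irrefl by (auto simp: \<B>_def S_def)
  qed
  \<comment> \<open>Thus \<open>v\<close> can be read off from the set, which makes the union over
    \<open>v\<close> disjoint.\<close>
  have insert_B_Int: "U \<inter> N = {v}" if "v \<in> N" "U \<in> insert v ` \<B> v" for v U
    using that by (auto simp: \<B>_def S_def)

  have "size_poly (\<Union>v\<in>N. insert v ` \<B> v) = (\<Sum>v\<in>N. size_poly (insert v ` \<B> v))"
    unfolding size_poly_def
  proof (rule sum.UNION_disjoint)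
    show "\<forall>v\<in>N. \<forall>w\<in>N. v \<noteq> w \<longrightarrow> insert v ` \<B> v \<inter> insert w ` \<B> w = {}"
      using insert_B_Int by (metis disjoint_iff singleton_inject)
  qed (use finN fin in auto)
  also have "\<dots> = (\<Sum>v\<in>N. polyX * size_poly (\<B> v))"
    by (intro sum.cong refl size_poly_insert_image)
      (use finV in \<open>auto simp: \<B>_def S_def intro: finite_subset\<close>)
  finally have "size_poly \<U> = size_poly \<T> + (\<Sum>v\<in>N. polyX * size_poly (\<B> v))"
    unfolding U using fin finN not_T by (subst size_poly_Un_disjoint) auto
  moreover have "size_poly (insert u ` \<U>) = polyX * size_poly \<U>"
    by (rule size_poly_insert_image) (use finV in \<open>auto simp: \<U>_def intro: finite_subset\<close>)
  moreover have "size_poly (\<A> \<union> insert u ` \<U>) = size_poly \<A> + size_poly (insert u ` \<U>)"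
    using fin by (intro size_poly_Un_disjoint) (auto simp: \<A>_def)
  moreover have "size_poly (\<A> \<union> \<R>) = size_poly \<A> + size_poly \<R>"
  proof (rule size_poly_Un_disjoint)
    \<comment> \<open>Members of \<open>\<A>\<close> dominate \<open>u\<close> and therefore meet
      \<open>N\<close>.\<close>
    show "\<A> \<inter> \<R> = {}" unfolding \<A>_def \<R>_def using uV N by blast
  qed (use fin in auto)
  moreover have "size_poly (\<T> \<union> \<R>) = size_poly \<T> + size_poly \<R>"
    using fin by (intro size_poly_Un_disjoint) (auto simp: \<T>_def \<R>_def)
  moreover have "total_dom_poly (with_proj G) = size_poly (\<A> \<union> insert u ` \<U>)"
    using finV by (simp add: total_dom_poly_eq G V_def)
  moreover have "total_dom_poly (del_vertex G u) = size_poly (\<A> \<union> \<R>)"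
    by (subst total_dom_poly_eq) (use finV A_R in \<open>auto simp: del_vertex_def V_def\<close>)
  moreover have "total_dom_poly (with_proj (contract_vertex G u)) = size_poly (\<T> \<union> \<R>)"
    by (subst total_dom_poly_eq) (use finV T_R arcs in auto)
  moreover have "total_dom_poly_restricted (with_proj (contract_vertex G u)) (\<lambda>W. N \<inter> W = {}) = size_poly \<R>"
    unfolding total_dom_poly_restricted_eq R ..
  moreover have "total_dom_poly_or_1 (del_closed_nbhds G u v) = size_poly (\<B> v)" for v
    by (subst total_dom_poly_or_1_eq) (use finV B in \<open>auto simp: del_closed_nbhds_def V_def\<close>)
  \<comment> \<open>Writing each family for its polynomial and s for the sum of all
    \<open>\<B> v\<close>, both sides equal \<open>\<A>\<close> + x \<open>\<T>\<close> + x^2 s; on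
    the right, (1 + x) \<open>\<R>\<close> cancels.\<close>
  ultimately show ?thesis
    unfolding N_def[symmetric]
    by (simp only: sum_distrib_left[symmetric] power2_eq_square) (simp only: algebra_simps)
qed

end
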